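(* Let $n$ be a positive integer and let $O$ be a (commutative) local ring with maximal ideal $\mathfrak{m}$ whose residue field $O/\mathfrak{m}$ has more than $n+1$ elements. Then every element of $\mathrm{SL}_n(O)$ that is not scalar modulo $\mathfrak{m}$ is a commutator in $\mathrm{SL}_n(O)$.
   Context: A matrix over $O$ is scalar modulo $\mathfrak{m}$ if its reduction, a matrix over $O/\mathfrak{m}$, is a scalar multiple of the identity matrix. An element $g$ of a group $\Gamma$ is a commutator in $\Gamma$ if $g=[g_1,g_2]=g_1g_2g_1^{-1}g_2^{-1}$ for some $g_1,g_2\in\Gamma$. *)

theory Defs
  imports
    "HOL-Algebra.QuotRing"
    "HOL-Algebra.Generated_Groups"
    "Jordan_Normal_Form.Determinant"
    "Jordan_Normal_Form.VS_Connect"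
begin

definition local_ring_with :: "('a, 'b) ring_scheme \<Rightarrow> 'a set \<Rightarrow> bool" where
  "local_ring_with R \<mm> \<longleftrightarrow>
     cring R \<and> maximalideal \<mm> R \<and> (\<forall>I. maximalideal I R \<longrightarrow> I = \<mm>)"

text \<open>The parameter \<open>ty\<close> only fixes the coefficient ring, as in \<open>ring_mat\<close>.\<close>

definition SL :: "'a :: comm_ring_1 itself \<Rightarrow> nat \<Rightarrow> 'a mat monoid" where
  "SL ty n = \<lparr>carrier = {A \<in> carrier_mat n n. det A = 1}, mult = (*), one = 1\<^sub>m n\<rparr>"

lemma group_SL: "group (SL TYPE('a :: comm_ring_1) n)"
proof (rule groupI)
  fix A :: "'a mat"
  assume "A \<in> carrier (SL TYPE('a) n)"
  hence A: "A \<in> carrier_mat n n" and d: "det A = 1" by (auto simp: SL_def)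
  note adj = adj_mat[OF A]
  have "det (adj_mat A) * det A = det (adj_mat A * A)"
    using adj(1) A by (simp add: det_mult)
  also have "\<dots> = 1" using adj(3) d by simp
  finally have "det (adj_mat A) = 1" using d by simp
  thus "\<exists>B\<in>carrier (SL TYPE('a) n). B \<otimes>\<^bsub>SL TYPE('a) n\<^esub> A = \<one>\<^bsub>SL TYPE('a) n\<^esub>"
    using adj d by (intro bexI[of _ "adj_mat A"]) (auto simp: SL_def)
qed (auto simp: SL_def det_mult)

text \<open>
  HOL-Algebra quotients have cosets as elements, so the reduction modulo \<open>\<mm>\<close> of a matrix is a
  matrix of cosets; the matrix operations of the library, which need a type class instance, do not
  apply to it. The scalar multiple of the identity is therefore written out entrywise in
  \<open>R Quot \<mm>\<close>.
\<close>

definition reduce_mat :: "('a, 'b) ring_scheme \<Rightarrow> 'a set \<Rightarrow> 'a mat \<Rightarrow> 'a set mat" where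
  "reduce_mat R \<mm> A = map_mat (\<lambda>a. \<mm> +>\<^bsub>R\<^esub> a) A"

definition scalar_mat_over :: "('a, 'b) ring_scheme \<Rightarrow> nat \<Rightarrow> 'a \<Rightarrow> 'a mat" where
  "scalar_mat_over K n c =
     mat n n (\<lambda>(i, j). c \<otimes>\<^bsub>K\<^esub> (if i = j then \<one>\<^bsub>K\<^esub> else \<zero>\<^bsub>K\<^esub>))"

definition scalar_modulo :: "('a, 'b) ring_scheme \<Rightarrow> 'a set \<Rightarrow> nat \<Rightarrow> 'a mat \<Rightarrow> bool" where
  "scalar_modulo R \<mm> n A \<longleftrightarrow>
     (\<exists>c \<in> carrier (R Quot \<mm>). reduce_mat R \<mm> A = scalar_mat_over (R Quot \<mm>) n c)"

end

theory Submission
  imports Defs "HOL-Algebra.Ring_Divisibility"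
begin

text \<open>
  The idea is that a product \<open>L U\<close> is a commutator as soon as \<open>U\<close> is conjugate to \<open>L\<inverse>\<close>: if
  \<open>U = R L\<inverse> R\<inverse>\<close>, then \<open>L U = [L, R]\<close>. Being a commutator in \<open>SL\<^sub>n\<close> is invariant under
  conjugation in \<open>GL\<^sub>n\<close>, so it suffices to write some conjugate of \<open>A\<close> in this form, with \<open>L\<close> and
  \<open>R\<close> of determinant one.

  A matrix that is not scalar modulo \<open>\<mm>\<close> is flexible enough for this. By Sourour's theorem
  (\<open>nonscalar_similar_lower_times_upper\<close>) it is conjugate to a product of a lower triangular \<open>L\<close> and
  an upper triangular \<open>U\<close> whose diagonals are arbitrary units, subject only to the determinant
  condition. The diagonal of \<open>L\<close> is chosen to consist of units \<open>\<beta>\<^sub>i\<close> that are distinct modulo \<open>\<mm>\<close> and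
  have product one, and that of \<open>U\<close> of their inverses. Distinctness modulo \<open>\<mm>\<close> makes both triangular
  matrices diagonalisable by conjugation with matrices of determinant one
  (\<open>lower_triangular_diagonalisable\<close>), so \<open>U\<close> is indeed conjugate to \<open>L\<inverse>\<close>.

  The size of the residue field is used for the choice of the \<open>\<beta>\<^sub>i\<close>
  (\<open>distinct_units_with_prod_one\<close>). The core of Sourour's theorem is that the Schur
  complement of a suitable corner entry can be kept nonscalar, so that an induction on \<open>n\<close> applies
  (\<open>nonscalar_similar_schur_complement\<close>).
\<close>

section \<open>Units of a local ring\<close>

text \<open>
  Zorn's lemma applies to the ideals above \<open>I\<close> that miss \<open>\<one>\<close>, because missing \<open>\<one>\<close> passes to unions of chains.
\<close>

lemma (in ring) proper_ideal_subset_maximalideal: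
  assumes I: "ideal I R" and one: "\<one> \<notin> I"
  shows "\<exists>M. maximalideal M R \<and> I \<subseteq> M"
proof -
  let ?F = "{J. ideal J R \<and> I \<subseteq> J \<and> \<one> \<notin> J}"
  have "\<exists>M\<in>?F. \<forall>X\<in>?F. M \<subseteq> X \<longrightarrow> X = M"
  proof (rule subset_Zorn)
    fix C assume C: "subset.chain ?F C"
    show "\<exists>U\<in>?F. \<forall>X\<in>C. X \<subseteq> U"
    proof (cases "C = {}")
      case True
      then show ?thesis using I one by blast
    next
      case False
      have CF: "C \<subseteq> ?F" using C unfolding subset.chain_def by simp
      have "subset.chain {J. ideal J R} C"
        using C unfolding subset.chain_def by auto
      hence "ideal (\<Union>C) R" using chain_Union_is_ideal[of C] False by simp
      moreover have "I \<subseteq> \<Union>C"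
      proof -
        obtain J where "J \<in> C" using False by auto
        thus ?thesis using CF by auto
      qed
      moreover have "\<one> \<notin> \<Union>C" using CF by auto
      ultimately have "\<Union>C \<in> ?F" by simp
      thus ?thesis by (rule bexI[rotated]) (rule ballI, rule Union_upper)
    qed
  qed
  then obtain M where M: "ideal M R" "I \<subseteq> M" "\<one> \<notin> M"
    and max: "\<And>X. \<lbrakk>ideal X R; I \<subseteq> X; \<one> \<notin> X; M \<subseteq> X\<rbrakk> \<Longrightarrow> X = M"
    by simp metis
  have "maximalideal M R"
  proof (rule maximalidealI[OF M(1)])
    show "carrier R \<noteq> M" using M(3) by blast
    fix J assume J: "ideal J R" "M \<subseteq> J" "J \<subseteq> carrier R"
    show "J = M \<or> J = carrier R"
    proof (cases "\<one> \<in> J")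
      case True
      then show ?thesis using ideal.one_imp_carrier[OF J(1)] by blast
    next
      case False
      then show ?thesis using max[OF J(1)] J(2) M(2) by blast
    qed
  qed
  thus ?thesis using M(2) by blast
qed

text \<open>
  A ring is local exactly when its nonunits are closed under addition. This elementary form of
  locality is what the matrix arguments use: \<open>x \<notin> \<mm>\<close> reads as ``\<open>x\<close> is a unit'', equivalently as ``\<open>x\<close> is
  nonzero in the residue field''.
\<close>

locale nonunit_ideal =
  fixes \<mm> :: "'a :: comm_ring_1 set"
  assumes nonunit: "x \<in> \<mm> \<longleftrightarrow> \<not> x dvd 1"
    and add: "x \<in> \<mm> \<Longrightarrow> y \<in> \<mm> \<Longrightarrow> x + y \<in> \<mm>"
begin

lemma mult_iff [simp]: "x * y \<in> \<mm> \<longleftrightarrow> x \<in> \<mm> \<or> y \<in> \<mm>"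
  unfolding nonunit using mult_dvd_mono[of x 1 y 1]
  by (auto dest: dvd_mult_left dvd_mult_right)

lemma zero [simp]: "0 \<in> \<mm>" and one [simp]: "1 \<notin> \<mm>"
  by (simp_all add: nonunit)

lemma uminus [simp]: "- x \<in> \<mm> \<longleftrightarrow> x \<in> \<mm>"
  by (simp add: nonunit)

lemma diff: "x \<in> \<mm> \<Longrightarrow> y \<in> \<mm> \<Longrightarrow> x - y \<in> \<mm>"
  using add[of x "- y"] by simp

lemma diff_commute: "x - y \<in> \<mm> \<longleftrightarrow> y - x \<in> \<mm>"
  using uminus[of "x - y"] by simp

lemma unit_add: "x \<notin> \<mm> \<Longrightarrow> y \<in> \<mm> \<Longrightarrow> x + y \<notin> \<mm>"
  using diff[of "x + y" y] by auto

lemma unit_diff: "x \<notin> \<mm> \<Longrightarrow> y \<in> \<mm> \<Longrightarrow> x - y \<notin> \<mm>"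
  using unit_add[of x "- y"] by simp

lemma diff_unit: "x \<in> \<mm> \<Longrightarrow> y \<notin> \<mm> \<Longrightarrow> x - y \<notin> \<mm>"
  using unit_diff[of y x] diff_commute by blast

lemma sum: "(\<And>i. i \<in> S \<Longrightarrow> f i \<in> \<mm>) \<Longrightarrow> sum f S \<in> \<mm>"
  by (induction S rule: infinite_finite_induct) (auto intro: add)

lemma inverseE:
  assumes "x \<notin> \<mm>"
  obtains y where "x * y = 1" "y \<notin> \<mm>"
proof -
  obtain y where y: "x * y = 1" using assms unfolding nonunit by (metis dvdE)
  hence "y dvd 1" by (metis dvd_triv_right)
  thus ?thesis using that y nonunit by blast
qed

end

text \<open>
  A nonunit generates a proper ideal, which lies in some maximal ideal, hence in the only one.
\<close>

lemma local_ring_with_nonunit_ideal: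
  fixes \<mm> :: "'a :: comm_ring_1 set"
  assumes "local_ring_with (class_ring :: 'a ring) \<mm>"
  shows "nonunit_ideal \<mm>"
proof -
  let ?R = "class_ring :: 'a ring"
  have max: "maximalideal \<mm> ?R" and uniq: "\<And>I. maximalideal I ?R \<Longrightarrow> I = \<mm>"
    using assms by (auto simp: local_ring_with_def)
  interpret M: maximalideal \<mm> ?R by (rule max)
  show ?thesis
  proof
    fix x y :: 'a
    show "x + y \<in> \<mm>" if "x \<in> \<mm>" "y \<in> \<mm>" using M.a_closed[OF that] by simp
    show "x \<in> \<mm> \<longleftrightarrow> \<not> x dvd 1"
    proof
      assume x: "x \<in> \<mm>"
      show "\<not> x dvd 1"
      proof
        assume "x dvd 1"
        then obtain z where "1 = x * z" by (elim dvdE)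
        hence "1 \<in> \<mm>" using M.I_r_closed[OF x, of z] by simp
        hence "\<mm> = UNIV" using M.one_imp_carrier by simp
        thus False using M.I_notcarr by simp
      qed
    next
      assume x: "\<not> x dvd 1"
      have id: "ideal (PIdl\<^bsub>?R\<^esub> x) ?R" by (rule cring.cgenideal_ideal) (auto intro: class_cring.cring_axioms)
      have "1 \<notin> PIdl\<^bsub>?R\<^esub> x" using x by (auto simp: cgenideal_def dvd_def mult.commute)
      then obtain I where "maximalideal I ?R" "PIdl\<^bsub>?R\<^esub> x \<subseteq> I"
        using class_ring.proper_ideal_subset_maximalideal[OF id] by auto
      thus "x \<in> \<mm>" using uniq ring.cgenideal_self[of ?R x] class_ring.ring_axioms by auto
    qed
  qed
qed

lemma (in nonunit_ideal) coset_eq_iff: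
  "\<mm> +>\<^bsub>class_ring\<^esub> a = \<mm> +>\<^bsub>class_ring\<^esub> b \<longleftrightarrow> a - b \<in> \<mm>"
proof -
  have c: "\<mm> +>\<^bsub>class_ring\<^esub> x = {h + x |h. h \<in> \<mm>}" for x
    by (auto simp: a_r_coset_def r_coset_def)
  show ?thesis
  proof
    assume "\<mm> +>\<^bsub>class_ring\<^esub> a = \<mm> +>\<^bsub>class_ring\<^esub> b"
    moreover have "a \<in> {h + a |h. h \<in> \<mm>}" by (auto intro!: exI[of _ 0])
    ultimately obtain h where "a = h + b" "h \<in> \<mm>" unfolding c by auto
    thus "a - b \<in> \<mm>" by simp
  next
    assume ab: "a - b \<in> \<mm>"
    have sub: "{h + x |h. h \<in> \<mm>} \<subseteq> {h + y |h. h \<in> \<mm>}" if "x - y \<in> \<mm>" for x y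
    proof (clarify)
      fix h assume "h \<in> \<mm>"
      thus "\<exists>k. h + x = k + y \<and> k \<in> \<mm>"
        using add[OF _ that] by (intro exI[of _ "h + (x - y)"]) simp
    qed
    show "\<mm> +>\<^bsub>class_ring\<^esub> a = \<mm> +>\<^bsub>class_ring\<^esub> b"
      unfolding c using sub[OF ab] sub[of b a] ab diff_commute by blast
  qed
qed

text \<open>
  The size of the residue field enters the later arguments only in this form: at most \<open>N\<close> elements
  cannot represent all residue classes.
\<close>

lemma (in nonunit_ideal) large_residue_field_avoids:
  fixes N :: nat
  assumes card: "infinite (carrier ((class_ring :: 'a ring) Quot \<mm>)) \<or>
         card (carrier ((class_ring :: 'a ring) Quot \<mm>)) > N"
    and S: "finite S" "card S \<le> N"
  shows "\<exists>x. \<forall>s\<in>S. x - s \<notin> \<mm>"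
proof (rule ccontr)
  let ?R = "class_ring :: 'a ring"
  let ?c = "\<lambda>a. \<mm> +>\<^bsub>?R\<^esub> a"
  assume "\<not> ?thesis"
  hence cover: "\<And>x. \<exists>s\<in>S. x - s \<in> \<mm>" by blast
  have "carrier (?R Quot \<mm>) \<subseteq> ?c ` S"
  proof
    fix X assume "X \<in> carrier (?R Quot \<mm>)"
    then obtain x where "X = ?c x"
      by (auto simp: FactRing_def A_RCOSETS_def RCOSETS_def a_r_coset_def)
    moreover obtain s where "s \<in> S" "x - s \<in> \<mm>" using cover by blast
    moreover have "?c x = ?c s"
      unfolding coset_eq_iff by fact
    ultimately show "X \<in> ?c ` S" by blast
  qed
  hence "finite (carrier (?R Quot \<mm>))" "card (carrier (?R Quot \<mm>)) \<le> card S"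
    using S(1) by (auto intro: finite_subset surj_card_le)
  thus False using card S(2) by simp
qed

section \<open>Distinct units with product one\<close>

text \<open>
  These units become the eigenvalues of a diagonal matrix of determinant one, with differences that
  are units. The set is grown by pairs \<open>{x, x\<inverse>}\<close>, which leave the product unchanged.
  For the new pair to be distinct modulo \<open>\<mm>\<close> from each other and from an inverse-closed set \<open>T\<close>, it is
  enough that \<open>x\<close> avoids \<open>0\<close>, \<open>1\<close>, \<open>- 1\<close> and \<open>T\<close> modulo \<open>\<mm>\<close>. In the last step \<open>T\<close> has
  \<open>n - 2\<close> elements, so at most \<open>n + 1\<close> classes are excluded. The start is the empty set when \<open>n\<close> is
  even and \<open>{1}\<close> when \<open>n\<close> is odd.
\<close>

lemma (in nonunit_ideal) distinct_units_with_prod_one: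
  assumes avoid: "\<And>S. finite S \<Longrightarrow> card S \<le> n + 1 \<Longrightarrow> \<exists>x. \<forall>s\<in>S. x - s \<notin> \<mm>"
  shows "\<exists>T. finite T \<and> card T = n \<and> \<Prod>T = 1 \<and> (\<forall>x\<in>T. \<exists>y\<in>T. x * y = 1) \<and>
    (\<forall>x\<in>T. \<forall>y\<in>T. x \<noteq> y \<longrightarrow> x - y \<notin> \<mm>)"
  using avoid
proof (induction n rule: nat_induct2)
  case 0
  show ?case by (rule exI[of _ "{}"]) simp
next
  case 1
  show ?case by (rule exI[of _ "{1}"]) simp
next
  case (step n)
  have avoid': "\<exists>x. \<forall>s\<in>S. x - s \<notin> \<mm>" if "finite S" "card S \<le> n + 1" for S
    using step.prems[of S] that by simp
  obtain T where T: "finite T" "card T = n" "\<Prod>T = 1" and inv: "\<And>x. x \<in> T \<Longrightarrow> \<exists>y\<in>T. x * y = 1"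
    and dist: "\<And>x y. \<lbrakk>x \<in> T; y \<in> T; x \<noteq> y\<rbrakk> \<Longrightarrow> x - y \<notin> \<mm>"
    using step.IH[OF avoid'] by auto
  let ?S = "T \<union> {0, 1, - 1}"
  have "card ?S \<le> n + 2 + 1"
    using T by (simp add: card_insert_if)
  then obtain x where "\<forall>s\<in>?S. x - s \<notin> \<mm>"
    using step.prems[of ?S] T(1) by auto
  hence x: "x \<notin> \<mm>" "x - 1 \<notin> \<mm>" "x + 1 \<notin> \<mm>" and xT: "\<And>t. t \<in> T \<Longrightarrow> x - t \<notin> \<mm>"
    by auto
  obtain y where y: "x * y = 1" "y \<notin> \<mm>" using x(1) by (rule inverseE)
  have "x * (x - y) = (x - 1) * (x + 1)" using y(1) by (simp add: algebra_simps)
  hence xy: "x - y \<notin> \<mm>" using x by (metis mult_iff)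
  have yT: "y - t \<notin> \<mm>" if "t \<in> T" for t
  proof -
    obtain u where u: "u \<in> T" "t * u = 1" using inv[OF \<open>t \<in> T\<close>] by blast
    have "x * u * (y - t) = (x * y) * u - x * (t * u)" by (simp add: algebra_simps)
    \<comment> \<open>Up to units, \<open>y - t\<close> is the difference of \<open>x\<close> and the inverse \<open>u\<close> of \<open>t\<close>, and \<open>u \<in> T\<close>.\<close>
    hence "x * u * (y - t) = u - x" using u y by simp
    thus ?thesis using xT[OF u(1)] diff_commute by (metis mult_iff)
  qed
  have new: "x \<notin> T" "y \<notin> T" "x \<noteq> y"
    using xT[of x] yT[of y] xy by auto
  let ?T = "insert x (insert y T)"
  have fin: "finite ?T" and card: "card ?T = n + 2" and prod: "\<Prod>?T = 1"
    using T new y by simp_all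
  have inv': "\<forall>u\<in>?T. \<exists>v\<in>?T. u * v = 1"
    using inv y(1) mult.commute[of x y] by auto
  have dist': "\<forall>u\<in>?T. \<forall>v\<in>?T. u \<noteq> v \<longrightarrow> u - v \<notin> \<mm>"
  proof -
    have "y - x \<notin> \<mm>" "\<And>t. t \<in> T \<Longrightarrow> t - x \<notin> \<mm>" "\<And>t. t \<in> T \<Longrightarrow> t - y \<notin> \<mm>"
      using xy xT yT diff_commute by blast+
    thus ?thesis using xy xT yT dist by simp
  qed
  show ?case
    by (intro exI[of _ ?T] conjI fin card prod inv' dist')
qed

section \<open>Block matrices with a one-by-one corner\<close>

lemma det_four_block_mat_upper_right_zero_row:
  assumes A1: "A1 \<in> carrier_mat 1 1" and A3: "A3 \<in> carrier_mat n 1" and A4: "A4 \<in> carrier_mat n n"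
  shows "det (four_block_mat A1 (0\<^sub>m 1 n) A3 A4) = det A1 * det A4"
proof -
  let ?M = "four_block_mat A1 (0\<^sub>m 1 n) A3 A4"
  have "?M \<in> carrier_mat (1 + n) (1 + n)" using A1 A4 by (rule four_block_carrier_mat)
  hence "det ?M = det (transpose_mat ?M)" by (simp only: det_transpose)
  also have "transpose_mat ?M =
      four_block_mat (transpose_mat A1) (transpose_mat A3) (0\<^sub>m n 1) (transpose_mat A4)"
    using transpose_four_block_mat[OF A1 zero_carrier_mat A3 A4] by simp
  also have "det \<dots> = det (transpose_mat A1) * det (transpose_mat A4)"
    using assms by (intro det_four_block_mat_lower_left_zero_col) auto
  finally show ?thesis using A1 A4 by (simp add: det_transpose)
qed

abbreviation mat11 :: "'a \<Rightarrow> 'a mat" where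
  "mat11 a \<equiv> mat 1 1 (\<lambda>_. a)"

lemma det_mat11 [simp]: "det (mat (Suc 0) (Suc 0) (\<lambda>_. a)) = a"
  using det_single[of "mat11 a"] by simp

text \<open>
  The argument \<open>a'\<close> stands for the inverse of the corner entry of \<open>B\<close>; it is passed explicitly because
  a general commutative ring has no inverse function.
\<close>

definition schur_complement :: "nat \<Rightarrow> 'a :: comm_ring_1 \<Rightarrow> 'a mat \<Rightarrow> 'a mat" where
  "schur_complement m a' B =
     mat m m (\<lambda>(i, j). B $$ (Suc i, Suc j) - B $$ (Suc i, 0) * a' * B $$ (0, Suc j))"

lemma schur_complement_carrier [simp]: "schur_complement m a' B \<in> carrier_mat m m"
  by (simp add: schur_complement_def)

text \<open>
  Block elimination of the first row and column. The factorisation \<open>x * y\<close> of the corner entry is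
  distributed over the two factors, which is how prescribed diagonal entries enter later on.
\<close>

lemma corner_decomposition:
  fixes B :: "'a :: comm_ring_1 mat"
  assumes B: "B \<in> carrier_mat (Suc m) (Suc m)" and x: "x * y = B $$ (0, 0)" and a': "B $$ (0, 0) * a' = 1"
  shows "B = four_block_mat (mat11 x) (0\<^sub>m 1 m) (mat m 1 (\<lambda>(i, j). B $$ (Suc i, 0) * (a' * x))) (1\<^sub>m m) *
    four_block_mat (mat11 y) (mat 1 m (\<lambda>(i, j). (a' * y) * B $$ (0, Suc j))) (0\<^sub>m m 1) (schur_complement m a' B)"
    (is "B = four_block_mat ?x ?z ?l ?i * four_block_mat ?y ?r ?z' ?S")
proof -
  have "four_block_mat ?x ?z ?l ?i * four_block_mat ?y ?r ?z' ?S =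
    four_block_mat (?x * ?y + ?z * ?z') (?x * ?r + ?z * ?S) (?l * ?y + ?i * ?z') (?l * ?r + ?i * ?S)"
    by (rule mult_four_block_mat[of _ 1 1 _ m _ m _ _ 1 _ m]) auto
  also have "?x * ?y + ?z * ?z' = mat11 (B $$ (0, 0))"
    by (rule eq_matI) (auto simp: scalar_prod_def x)
  also have "?x * ?r + ?z * ?S = mat 1 m (\<lambda>(i, j). B $$ (0, Suc j))"
  proof (rule eq_matI)
    fix i j assume ij: "i < dim_row (mat 1 m (\<lambda>(i, j). B $$ (0, Suc j)))"
      "j < dim_col (mat 1 m (\<lambda>(i, j). B $$ (0, Suc j)))"
    have "x * ((a' * y) * B $$ (0, Suc j)) = ((x * y) * a') * B $$ (0, Suc j)" by (simp only: ac_simps)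
    also have "\<dots> = B $$ (0, Suc j)" by (simp add: x a')
    finally show "(?x * ?r + ?z * ?S) $$ (i, j) = mat 1 m (\<lambda>(i, j). B $$ (0, Suc j)) $$ (i, j)"
      using ij by (simp add: scalar_prod_def schur_complement_def)
  qed (auto simp: schur_complement_def)
  also have "?l * ?y + ?i * ?z' = mat m 1 (\<lambda>(i, j). B $$ (Suc i, 0))"
  proof (rule eq_matI)
    fix i j assume ij: "i < dim_row (mat m 1 (\<lambda>(i, j). B $$ (Suc i, 0)))"
      "j < dim_col (mat m 1 (\<lambda>(i, j). B $$ (Suc i, 0)))"
    have "B $$ (Suc i, 0) * (a' * x) * y = B $$ (Suc i, 0) * ((x * y) * a')" by (simp only: ac_simps)
    also have "\<dots> = B $$ (Suc i, 0)" by (simp add: x a')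
    finally show "(?l * ?y + ?i * ?z') $$ (i, j) = mat m 1 (\<lambda>(i, j). B $$ (Suc i, 0)) $$ (i, j)"
      using ij by (simp add: scalar_prod_def)
  qed auto
  also have "?l * ?r + ?i * ?S = mat m m (\<lambda>(i, j). B $$ (Suc i, Suc j))"
  proof (rule eq_matI)
    fix i j assume ij: "i < dim_row (mat m m (\<lambda>(i, j). B $$ (Suc i, Suc j)))"
      "j < dim_col (mat m m (\<lambda>(i, j). B $$ (Suc i, Suc j)))"
    have "?i * ?S = ?S" by (rule left_mult_one_mat[OF schur_complement_carrier])
    moreover have "B $$ (Suc i, 0) * (a' * x) * ((a' * y) * B $$ (0, Suc j)) =
        B $$ (Suc i, 0) * a' * B $$ (0, Suc j) * ((x * y) * a')" by (simp only: ac_simps)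
    hence "B $$ (Suc i, 0) * (a' * x) * ((a' * y) * B $$ (0, Suc j)) = B $$ (Suc i, 0) * a' * B $$ (0, Suc j)"
      by (simp add: x a')
    ultimately show "(?l * ?r + ?i * ?S) $$ (i, j) = mat m m (\<lambda>(i, j). B $$ (Suc i, Suc j)) $$ (i, j)"
      using ij by (simp add: scalar_prod_def schur_complement_def)
  qed (auto simp: schur_complement_def)
  also have "four_block_mat (mat11 (B $$ (0, 0))) (mat 1 m (\<lambda>(i, j). B $$ (0, Suc j)))
     (mat m 1 (\<lambda>(i, j). B $$ (Suc i, 0))) (mat m m (\<lambda>(i, j). B $$ (Suc i, Suc j))) = B"
    by (rule eq_matI) (use B in \<open>auto simp: less_Suc_eq_0_disj\<close>)
  finally show ?thesis ..
qed

lemma det_schur_complement: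
  fixes B :: "'a :: comm_ring_1 mat"
  assumes B: "B \<in> carrier_mat (Suc m) (Suc m)" and a': "B $$ (0, 0) * a' = 1"
  shows "det B = B $$ (0, 0) * det (schur_complement m a' B)"
proof -
  let ?L = "four_block_mat (mat11 1) (0\<^sub>m 1 m) (mat m 1 (\<lambda>(i, j). B $$ (Suc i, 0) * (a' * 1))) (1\<^sub>m m)"
  let ?U = "four_block_mat (mat11 (B $$ (0, 0))) (mat 1 m (\<lambda>(i, j). (a' * B $$ (0, 0)) * B $$ (0, Suc j)))
     (0\<^sub>m m 1) (schur_complement m a' B)"
  have "det B = det (?L * ?U)" using corner_decomposition[OF B _ a', of 1 "B $$ (0, 0)"] by simp
  also have "\<dots> = det ?L * det ?U"
    by (rule det_mult[of _ "1 + m"]; rule four_block_carrier_mat) auto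
  also have "det ?L = det (mat11 (1::'a)) * det (1\<^sub>m m :: 'a mat)"
    by (rule det_four_block_mat_upper_right_zero_row) auto
  also have "det ?U = det (mat11 (B $$ (0, 0))) * det (schur_complement m a' B)"
    by (rule det_four_block_mat_lower_left_zero_col) auto
  finally show ?thesis by simp
qed

section \<open>Diagonalising triangular matrices\<close>

text \<open>
  By induction the lower right block becomes a diagonal matrix \<open>D'\<close> through \<open>P\<close>. The remaining
  column \<open>l\<close> is cleared by a unipotent conjugation with a column \<open>y\<close> that solves
  \<open>(d 0 - D') y = Q l\<close>; this system is diagonal, and solvable because the differences of the
  diagonal entries are units. The conjugating matrix is unipotent triangular, whence its determinant.
\<close>

lemma (in nonunit_ideal) lower_triangular_diagonalisable:
  assumes "L \<in> carrier_mat n n" and "\<And>i j. i < j \<Longrightarrow> j < n \<Longrightarrow> L $$ (i, j) = 0"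
    and "\<And>i. i < n \<Longrightarrow> L $$ (i, i) = d i"
    and "\<And>i j. i < j \<Longrightarrow> j < n \<Longrightarrow> d i - d j \<notin> \<mm>"
  shows "\<exists>P Q. similar_mat_wit L (mat_diag n d) P Q \<and> det P = 1"
  using assms
proof (induction n arbitrary: L d)
  case 0
  have "L = mat_diag 0 d" using 0 by (intro eq_matI) (auto simp: mat_diag_def)
  then show ?case using similar_mat_wit_refl[OF 0(1)] by (intro exI[of _ "1\<^sub>m 0"]) auto
next
  case (Suc m)
  define l where "l = mat m 1 (\<lambda>(i, j). L $$ (Suc i, 0))"
  define L' where "L' = mat m m (\<lambda>(i, j). L $$ (Suc i, Suc j))"
  let ?d = "\<lambda>i. d (Suc i)"
  let ?D = "mat_diag m ?d"
  have L: "L = four_block_mat (mat11 (d 0)) (0\<^sub>m 1 m) l L'"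
    by (rule eq_matI) (use Suc.prems in \<open>auto simp: l_def L'_def less_Suc_eq_0_disj\<close>)
  have L': "L' \<in> carrier_mat m m" by (simp add: L'_def)
  have "\<exists>P Q. similar_mat_wit L' ?D P Q \<and> det P = 1"
    by (rule Suc.IH) (use Suc.prems in \<open>auto simp: L'_def\<close>)
  then obtain P Q where PQ: "similar_mat_wit L' ?D P Q" and detP: "det P = 1" by blast
  note w = similar_mat_witD2[OF L' PQ]
  have "\<exists>e. (d 0 - ?d i) * e = 1" if "i < m" for i
    using Suc.prems(4)[of 0 "Suc i"] that by (metis inverseE Suc_less_eq zero_less_Suc)
  then obtain e where e: "\<And>i. i < m \<Longrightarrow> (d 0 - ?d i) * e i = 1" by metis
  have l: "l \<in> carrier_mat m 1" by (simp add: l_def)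
  define y where "y = mat m 1 (\<lambda>(i, j). e i * (Q * l) $$ (i, 0))"
  have y: "y \<in> carrier_mat m 1" by (simp add: y_def)
  have Ql: "Q * l \<in> carrier_mat m 1" using w l by simp
  have ye: "d 0 \<cdot>\<^sub>m y - ?D * y = Q * l"
  proof (rule eq_matI)
    fix i j assume ij: "i < dim_row (Q * l)" "j < dim_col (Q * l)"
    hence i: "i < m" "j = 0" using Ql by auto
    have "(?D * y) $$ (i, 0) = ?d i * y $$ (i, 0)" using i by (simp add: mat_diag_mult_left[OF y])
    moreover have "(d 0 \<cdot>\<^sub>m y - ?D * y) $$ (i, j) = d 0 * y $$ (i, 0) - (?D * y) $$ (i, 0)"
      using i y mat_diag_mult_left[OF y] by simp
    ultimately have "(d 0 \<cdot>\<^sub>m y - ?D * y) $$ (i, j) = (d 0 - ?d i) * y $$ (i, 0)"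
      by (simp add: left_diff_distrib)
    also have "y $$ (i, 0) = e i * (Q * l) $$ (i, 0)" using i by (simp add: y_def)
    also have "(d 0 - ?d i) * \<dots> = ((d 0 - ?d i) * e i) * (Q * l) $$ (i, 0)" by (simp only: mult.assoc)
    finally show "(d 0 \<cdot>\<^sub>m y - ?D * y) $$ (i, j) = (Q * l) $$ (i, j)" using e[OF i(1)] i by simp
  qed (use y Ql mat_diag_mult_left[OF y] in auto)
  let ?P = "four_block_mat (mat11 1) (0\<^sub>m 1 m) (P * y) P"
  let ?Q = "four_block_mat (mat11 1) (0\<^sub>m 1 m) (- y) Q"
  let ?E = "four_block_mat (mat11 (d 0)) (0\<^sub>m 1 m) (0\<^sub>m m 1) ?D"
  have one: "mat11 (1::'a) = 1\<^sub>m 1" by (rule eq_matI) auto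
  have block: "four_block_mat (mat11 a) (0\<^sub>m 1 m) X Y * four_block_mat (mat11 b) (0\<^sub>m 1 m) Z W =
      four_block_mat (mat11 (a * b)) (0\<^sub>m 1 m) (b \<cdot>\<^sub>m X + Y * Z) (Y * W)"
    if X: "X \<in> carrier_mat m 1" and Y: "Y \<in> carrier_mat m m" and Z: "Z \<in> carrier_mat m 1"
      and W: "W \<in> carrier_mat m m" for a b :: 'a and X Y Z W
  proof -
    have "X * mat11 b = b \<cdot>\<^sub>m X" using X by (intro eq_matI) (auto simp: scalar_prod_def mult.commute)
    moreover have "mat11 a * mat11 b = mat11 (a * b)" by (rule eq_matI) (auto simp: scalar_prod_def)
    ultimately show ?thesis
      by (subst mult_four_block_mat[of _ 1 1 _ m _ m _ _ 1 _ m]) (use that in auto)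
  qed
  have Py: "P * y \<in> carrier_mat m 1" using w y by simp
  have PQ1: "?P * ?Q = 1\<^sub>m (1 + m)"
  proof -
    have "?P * ?Q = four_block_mat (mat11 (1 * 1)) (0\<^sub>m 1 m) (1 \<cdot>\<^sub>m (P * y) + P * (- y)) (P * Q)"
      by (rule block) (use w y Py in auto)
    also have "1 \<cdot>\<^sub>m (P * y) + P * (- y) = 0\<^sub>m m 1"
      using w y Py by (intro eq_matI) (auto simp: scalar_prod_def sum_negf)
    finally show ?thesis using w by (simp add: one del: One_nat_def)
  qed
  have QP1: "?Q * ?P = 1\<^sub>m (1 + m)"
  proof -
    have "?Q * ?P = four_block_mat (mat11 (1 * 1)) (0\<^sub>m 1 m) (1 \<cdot>\<^sub>m (- y) + Q * (P * y)) (Q * P)"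
      by (rule block) (use w y Py in auto)
    also have "Q * (P * y) = y" using w y by (simp add: assoc_mult_mat[of Q m m P m y 1, symmetric])
    also have "1 \<cdot>\<^sub>m (- y) + y = 0\<^sub>m m 1" using y by (intro eq_matI) auto
    finally show ?thesis using w by (simp add: one del: One_nat_def)
  qed
  have conj: "L = ?P * ?E * ?Q"
  proof -
    have "?P * ?E = four_block_mat (mat11 (1 * d 0)) (0\<^sub>m 1 m) (d 0 \<cdot>\<^sub>m (P * y) + P * 0\<^sub>m m 1) (P * ?D)"
      by (rule block) (use w y Py in auto)
    also have "d 0 \<cdot>\<^sub>m (P * y) + P * 0\<^sub>m m 1 = d 0 \<cdot>\<^sub>m (P * y)" using w Py by simp
    finally have "?P * ?E * ?Q = four_block_mat (mat11 (1 * d 0)) (0\<^sub>m 1 m) (d 0 \<cdot>\<^sub>m (P * y)) (P * ?D) * ?Q"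
      by simp
    also have "\<dots> = four_block_mat (mat11 (1 * d 0 * 1)) (0\<^sub>m 1 m)
        (1 \<cdot>\<^sub>m (d 0 \<cdot>\<^sub>m (P * y)) + (P * ?D) * (- y)) (P * ?D * Q)"
      by (rule block) (use w y Py in auto)
    also have "1 \<cdot>\<^sub>m (d 0 \<cdot>\<^sub>m (P * y)) + (P * ?D) * (- y) = P * (d 0 \<cdot>\<^sub>m y - ?D * y)"
    proof -
      have "P * (d 0 \<cdot>\<^sub>m y - ?D * y) = P * (d 0 \<cdot>\<^sub>m y) - P * (?D * y)"
        by (rule mult_minus_distrib_mat[of _ m m _ 1]) (use w y mult_carrier_mat[OF mat_diag_dim y] in auto)
      also have "P * (d 0 \<cdot>\<^sub>m y) = d 0 \<cdot>\<^sub>m (P * y)" using w y by (simp add: mult_smult_distrib)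
      also have "P * (?D * y) = P * ?D * y" using w y by (simp add: assoc_mult_mat[of P m m ?D m y 1])
      finally have e1: "P * (d 0 \<cdot>\<^sub>m y - ?D * y) = d 0 \<cdot>\<^sub>m (P * y) - P * ?D * y" .
      have PD: "P * ?D \<in> carrier_mat m m" using w by simp
      show ?thesis unfolding e1
        by (rule eq_matI) (use Py PD y in \<open>auto simp: scalar_prod_def sum_negf\<close>)
    qed
    also have "P * (d 0 \<cdot>\<^sub>m y - ?D * y) = l"
      unfolding ye using w l by (simp add: assoc_mult_mat[of P m m Q m l 1, symmetric])
    finally show ?thesis using w(3) L by simp
  qed
  have E: "?E = mat_diag (Suc m) d"
    by (rule eq_matI) (auto simp: mat_diag_def)
  have "similar_mat_wit L (mat_diag (Suc m) d) ?P ?Q"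
    by (rule similar_mat_witI[OF PQ1 QP1 conj[unfolded E]]) (use w Suc.prems in auto)
  moreover have "det ?P = det (mat11 (1::'a)) * det P"
    by (rule det_four_block_mat_upper_right_zero_row) (use w Py in auto)
  hence "det ?P = 1" using detP by simp
  ultimately show ?case by metis
qed

lemma (in nonunit_ideal) upper_triangular_diagonalisable:
  assumes U: "U \<in> carrier_mat n n" and ut: "\<And>i j. j < i \<Longrightarrow> i < n \<Longrightarrow> U $$ (i, j) = 0"
    and "\<And>i. i < n \<Longrightarrow> U $$ (i, i) = d i"
    and "\<And>i j. i < j \<Longrightarrow> j < n \<Longrightarrow> d i - d j \<notin> \<mm>"
  shows "\<exists>P Q. similar_mat_wit U (mat_diag n d) P Q \<and> det P = 1"
proof -
  have "\<exists>P Q. similar_mat_wit (transpose_mat U) (mat_diag n d) P Q \<and> det P = 1"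
    by (rule lower_triangular_diagonalisable) (use assms in auto)
  then obtain P Q where PQ: "similar_mat_wit (transpose_mat U) (mat_diag n d) P Q" and P: "det P = 1"
    by blast
  have Ut: "transpose_mat U \<in> carrier_mat n n" using U by simp
  note w = similar_mat_witD2[OF Ut PQ]
  have D: "transpose_mat (mat_diag n d) = mat_diag n d" by (rule eq_matI) (auto simp: mat_diag_def)
  let ?P = "transpose_mat P" and ?Q = "transpose_mat Q"
  have "similar_mat_wit U (mat_diag n d) ?Q ?P"
  proof (rule similar_mat_witI[of _ _ n])
    show "?Q * ?P = 1\<^sub>m n" using transpose_mult[of P n n Q n] w by simp
    show "?P * ?Q = 1\<^sub>m n" using transpose_mult[of Q n n P n] w by simp
    have "U = transpose_mat (P * mat_diag n d * Q)" using w(3) by (metis transpose_transpose)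
    also have "\<dots> = ?Q * transpose_mat (P * mat_diag n d)"
      by (rule transpose_mult[of _ n n _ n]) (use w in auto)
    also have "transpose_mat (P * mat_diag n d) = mat_diag n d * ?P"
      using transpose_mult[of P n n "mat_diag n d" n] w D by simp
    also have "?Q * (mat_diag n d * ?P) = ?Q * mat_diag n d * ?P"
      by (rule assoc_mult_mat[of _ n n _ n _ n, symmetric]) (use w in auto)
    finally show "U = ?Q * mat_diag n d * ?P" .
  qed (use w U in auto)
  moreover have "det ?Q = 1"
    using det_mult[of P n Q] w P det_transpose[of Q n] by simp
  ultimately show ?thesis by blast
qed

section \<open>Schur complements of matrices that are not scalar\<close>

context nonunit_ideal
begin

text \<open>
  Entrywise form of ``not scalar modulo \<open>\<mm>\<close>''; the link is the lemma
  \<open>not_scalar_modulo_imp_nonscalar\<close>.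
\<close>

definition nonscalar :: "nat \<Rightarrow> 'a mat \<Rightarrow> bool" where
  "nonscalar n A \<longleftrightarrow> (\<exists>i<n. \<exists>j<n. i \<noteq> j \<and> A $$ (i, j) \<notin> \<mm>) \<or>
     (\<exists>i<n. \<exists>j<n. A $$ (i, i) - A $$ (j, j) \<notin> \<mm>)"

text \<open>
  If all off-diagonal entries are nonunits, two diagonal entries differ by a unit, and an elementary
  conjugation moves this difference off the diagonal.
\<close>

lemma nonscalar_similar_offdiagonal_unit:
  assumes A: "A \<in> carrier_mat n n" and ns: "nonscalar n A"
  shows "\<exists>B i j. B \<in> carrier_mat n n \<and> similar_mat B A \<and> i < n \<and> j < n \<and> i \<noteq> j \<and> B $$ (i, j) \<notin> \<mm>"
proof (cases "\<exists>i<n. \<exists>j<n. i \<noteq> j \<and> A $$ (i, j) \<notin> \<mm>")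
  case True
  then show ?thesis using A similar_mat_refl[OF A] by blast
next
  case False
  then obtain i j where ij: "i < n" "j < n" and d: "A $$ (i, i) - A $$ (j, j) \<notin> \<mm>"
    using ns unfolding nonscalar_def by blast
  have neq: "i \<noteq> j" using d by auto
  have off: "A $$ (i, j) \<in> \<mm>" "A $$ (j, i) \<in> \<mm>" using False ij neq by blast+
  let ?B = "add_col_sub_row 1 i j A"
  have "?B $$ (i, j) = (A $$ (i, i) - A $$ (j, j)) + (A $$ (i, j) - A $$ (j, i))"
    using A ij neq by simp
  hence "?B $$ (i, j) \<notin> \<mm>" using unit_add[OF d diff[OF off]] by simp
  thus ?thesis using add_col_sub_row_similar[OF A ij neq] add_col_sub_row_carrier(3)[OF A] ij neq
    by blast
qed

text \<open>
  In terms of bases, some vector \<open>v\<close> is linearly independent of \<open>A v\<close> modulo \<open>\<mm>\<close>, and a basis that starts with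
  \<open>v\<close> and a suitable combination of \<open>v\<close> and \<open>A v\<close> gives the corner entry any prescribed value. Here
  this is done by elementary conjugations: permutations bring a unit to position \<open>(1, 0)\<close>, and the
  unit is then used as a pivot to set the entry above it to \<open>a\<close> and the one below it to \<open>0\<close>.
\<close>

lemma nonscalar_similar_first_column:
  assumes A: "A \<in> carrier_mat n n" and ns: "nonscalar n A"
  shows "\<exists>B. B \<in> carrier_mat n n \<and> similar_mat B A \<and> 1 < n \<and>
    B $$ (0, 0) = a \<and> B $$ (1, 0) \<notin> \<mm> \<and> (2 < n \<longrightarrow> B $$ (2, 0) = 0)"
proof -
  obtain B i j where B: "B \<in> carrier_mat n n" "similar_mat B A" and ij: "i < n" "j < n" "i \<noteq> j"
    and Bij: "B $$ (i, j) \<notin> \<mm>"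
    using nonscalar_similar_offdiagonal_unit[OF A ns] by blast
  have n: "1 < n" using ij by linarith
  define B1 where "B1 = swap_cols_rows 0 j B"
  define k where "k = (if i = 0 then j else i)"
  have k: "k < n" "k \<noteq> 0" using ij by (auto simp: k_def)
  have B1: "B1 \<in> carrier_mat n n" "similar_mat B1 A"
    using B n ij similar_mat_trans[OF swap_cols_rows_similar[OF B(1), of 0 j] B(2)]
    by (auto simp: B1_def)
  have "B1 $$ (k, 0) = B $$ (i, j)"
    using B ij n by (auto simp: B1_def k_def)
  define B2 where "B2 = swap_cols_rows 1 k B1"
  have B2: "B2 \<in> carrier_mat n n" "similar_mat B2 A"
    using B1 n k similar_mat_trans[OF swap_cols_rows_similar[OF B1(1), of 1 k] B1(2)]
    by (auto simp: B2_def)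
  have "B2 $$ (1, 0) = B1 $$ (k, 0)"
    using B1 k n by (auto simp: B2_def)
  hence u: "B2 $$ (1, 0) \<notin> \<mm>" using Bij \<open>B1 $$ (k, 0) = B $$ (i, j)\<close> by simp
  then obtain v where v: "B2 $$ (1, 0) * v = 1" by (rule inverseE)
  define B3 where "B3 = add_col_sub_row ((B2 $$ (0, 0) - a) * v) 0 1 B2"
  have B3: "B3 \<in> carrier_mat n n" "similar_mat B3 A"
    using B2 n similar_mat_trans[OF add_col_sub_row_similar[OF B2(1), of 0 1] B2(2)]
    by (auto simp: B3_def)
  have "B3 $$ (0, 0) = B2 $$ (0, 0) - (B2 $$ (0, 0) - a) * (B2 $$ (1, 0) * v)"
    using B2 n by (simp add: B3_def ac_simps)
  hence B3a: "B3 $$ (0, 0) = a" using v by simp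
  have B3u: "B3 $$ (1, 0) = B2 $$ (1, 0)" using B2 n by (simp add: B3_def)
  show ?thesis
  proof (cases "2 < n")
    case False
    then show ?thesis using B3 B3a B3u u n by auto
  next
    case n2: True
    define B4 where "B4 = add_col_sub_row (B3 $$ (2, 0) * v) 2 1 B3"
    have B4: "B4 \<in> carrier_mat n n" "similar_mat B4 A"
      using B3 n n2 similar_mat_trans[OF add_col_sub_row_similar[OF B3(1), of 2 1] B3(2)]
      by (auto simp: B4_def)
    have "B4 $$ (2, 0) = B3 $$ (2, 0) - B3 $$ (2, 0) * (B2 $$ (1, 0) * v)"
      using B3 n2 B3u by (simp add: B4_def ac_simps)
    hence "B4 $$ (2, 0) = 0" using v by simp
    moreover have "B4 $$ (0, 0) = a" "B4 $$ (1, 0) \<notin> \<mm>"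
      using B3 n2 B3a B3u u by (simp_all add: B4_def)
    ultimately show ?thesis using B4 n by blast
  qed
qed

text \<open>
  This makes the induction for the triangular factorisation work: the Schur complement \<open>S\<close> of the
  corner must again fail to be scalar modulo \<open>\<mm>\<close>, unless it has size at most one. If it is scalar, then the zero at position \<open>(2, 0)\<close> allows one more
  elementary conjugation, adding row 2 to row 0 and subtracting column 0 from column 2. It keeps the
  first column and replaces \<open>S\<close> by \<open>S\<close> minus the product of the first column (below the corner),
  \<open>a'\<close> and row 1 of \<open>S\<close>. The scalar is a unit because \<open>det S\<close> is, so this produces a unit at
  position \<open>(0, 1)\<close>.
\<close>

lemma nonscalar_similar_schur_complement:
  assumes A: "A \<in> carrier_mat (Suc m) (Suc m)" and ns: "nonscalar (Suc m) A" and det: "det A \<notin> \<mm>"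
    and a': "a * a' = 1"
  shows "\<exists>B. B \<in> carrier_mat (Suc m) (Suc m) \<and> similar_mat B A \<and> B $$ (0, 0) = a \<and>
    (m \<le> 1 \<or> nonscalar m (schur_complement m a' B))"
proof -
  obtain B where B: "B \<in> carrier_mat (Suc m) (Suc m)" "similar_mat B A" and m: "1 < Suc m"
    and Ba: "B $$ (0, 0) = a" and u: "B $$ (1, 0) \<notin> \<mm>" and B2: "2 < Suc m \<longrightarrow> B $$ (2, 0) = 0"
    using nonscalar_similar_first_column[OF A ns] by blast
  let ?S = "schur_complement m a' B"
  show ?thesis
  proof (cases "m \<le> 1 \<or> nonscalar m ?S")
    case True
    then show ?thesis using B Ba by blast
  next
    case False
    hence m: "1 < m" and scalar: "\<not> nonscalar m ?S" by auto
    have S_off: "?S $$ (i, j) \<in> \<mm>" if "i < m" "j < m" "i \<noteq> j" for i j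
      using scalar that unfolding nonscalar_def by blast
    have S11: "?S $$ (1, 1) \<notin> \<mm>"
    proof
      assume "?S $$ (1, 1) \<in> \<mm>"
      hence "?S $$ (i, 1) \<in> \<mm>" if "i < m" for i using S_off[OF that m] by (cases "i = 1") auto
      \<comment> \<open>Expanding along column 1, all of whose entries would be nonunits.\<close>
      hence "det ?S \<in> \<mm>"
        unfolding laplace_expansion_column[OF schur_complement_carrier m] by (intro sum) auto
      hence "det B \<in> \<mm>" using det_schur_complement[OF B(1)] Ba a' by simp
      thus False using det det_similar[OF B(2)] by simp
    qed
    have e: "?S $$ (1, 1) = B $$ (2, 2)" "?S $$ (0, 1) = B $$ (1, 2) - B $$ (1, 0) * a' * B $$ (0, 2)"
      using m B2 by (simp_all add: schur_complement_def numeral_2_eq_2)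
    define C where "C = add_col_sub_row (- 1) 0 2 B"
    have C: "C \<in> carrier_mat (Suc m) (Suc m)" "similar_mat C A"
      using B m similar_mat_trans[OF add_col_sub_row_similar[OF B(1), of 0 2] B(2)]
      by (auto simp: C_def)
    have Ca: "C $$ (0, 0) = a" using B m Ba B2 by (simp add: C_def)
    have c: "C $$ (1, 2) = B $$ (1, 2) - B $$ (1, 0)" "C $$ (1, 0) = B $$ (1, 0)"
      "C $$ (0, 2) = B $$ (0, 2) - a + B $$ (2, 2)"
      using B m Ba B2 by (simp_all add: C_def)
    have "schur_complement m a' C $$ (0, 1) =
        (B $$ (1, 2) - B $$ (1, 0)) - B $$ (1, 0) * a' * (B $$ (0, 2) - a + B $$ (2, 2))"
      using m c by (simp add: schur_complement_def numeral_2_eq_2)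
    also have "\<dots> = ?S $$ (0, 1) - B $$ (1, 0) * a' * ?S $$ (1, 1) + B $$ (1, 0) * (a * a' - 1)"
      unfolding e by (simp add: algebra_simps)
    also have "\<dots> = ?S $$ (0, 1) - B $$ (1, 0) * a' * ?S $$ (1, 1)" by (simp add: a')
    also have "\<dots> \<notin> \<mm>"
    proof (rule diff_unit)
      have "a' \<notin> \<mm>" using a' by (metis mult_iff one)
      thus "B $$ (1, 0) * a' * ?S $$ (1, 1) \<notin> \<mm>" using u S11 by simp
    qed (use S_off m in simp)
    finally have "schur_complement m a' C $$ (0, 1) \<notin> \<mm>" .
    hence "nonscalar m (schur_complement m a' C)"
      unfolding nonscalar_def using m by (intro disjI1 exI[of _ 0] exI[of _ 1] conjI) auto
    thus ?thesis using C Ca by blast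
  qed
qed

section \<open>A triangular factorisation with prescribed diagonals\<close>

text \<open>
  Sourour's factorisation theorem over a local ring. The corner entry is arranged to be
  \<open>\<beta> 0 * \<gamma> 0\<close>, the Schur complement is factored by induction up to a conjugation by \<open>P\<close>, and
  conjugating by the block matrix with diagonal blocks \<open>1\<close> and \<open>P\<close> carries this factorisation over
  to the whole matrix. The determinant condition takes care of the last diagonal entry.
\<close>

lemma nonscalar_similar_lower_times_upper:
  assumes "A \<in> carrier_mat n n" and "n \<le> 1 \<or> nonscalar n A"
    and "\<And>i. i < n \<Longrightarrow> \<beta> i \<notin> \<mm>" and "\<And>i. i < n \<Longrightarrow> \<gamma> i \<notin> \<mm>"
    and "det A = (\<Prod>i<n. \<beta> i * \<gamma> i)"
  shows "\<exists>L U. L \<in> carrier_mat n n \<and> U \<in> carrier_mat n n \<and> similar_mat A (L * U) \<and>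
    (\<forall>i j. i < j \<longrightarrow> j < n \<longrightarrow> L $$ (i, j) = 0) \<and> (\<forall>i j. j < i \<longrightarrow> i < n \<longrightarrow> U $$ (i, j) = 0) \<and>
    (\<forall>i<n. L $$ (i, i) = \<beta> i \<and> U $$ (i, i) = \<gamma> i)"
  using assms
proof (induction n arbitrary: A \<beta> \<gamma>)
  case 0
  have "A * 1\<^sub>m 0 = A" using 0(1) by simp
  then show ?case using 0(1) similar_mat_refl[OF 0(1)]
    by (intro exI[of _ A] exI[of _ "1\<^sub>m 0"]) simp
next
  case (Suc m)
  let ?a = "\<beta> 0 * \<gamma> 0"
  have \<beta>0: "\<beta> 0 \<notin> \<mm>" and \<gamma>0: "\<gamma> 0 \<notin> \<mm>" using Suc.prems by auto
  then obtain a' where a': "?a * a' = 1" by (metis mult_iff inverseE)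
  have detA: "det A = ?a * (\<Prod>i<m. \<beta> (Suc i) * \<gamma> (Suc i))"
    unfolding Suc.prems(5) by (simp only: prod.lessThan_Suc_shift)
  have unit_det: "det A \<notin> \<mm>"
  proof -
    have partial: "(\<Prod>i<k. \<beta> i * \<gamma> i) \<notin> \<mm>" if "k \<le> Suc m" for k
      using that Suc.prems(3,4) by (induction k) auto
    show ?thesis unfolding Suc.prems(5) by (rule partial) simp
  qed
  have "\<exists>B. B \<in> carrier_mat (Suc m) (Suc m) \<and> similar_mat B A \<and> B $$ (0, 0) = ?a \<and>
    (m \<le> 1 \<or> nonscalar m (schur_complement m a' B))"
  proof (cases "m = 0")
    case True
    have "det A = A $$ (0, 0)" using det_single[of A] Suc.prems(1) True by simp
    then show ?thesis using Suc.prems(1) similar_mat_refl[OF Suc.prems(1)] True detA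
      by (intro exI[of _ A]) simp
  next
    case False
    then show ?thesis
      using nonscalar_similar_schur_complement[OF Suc.prems(1) _ unit_det a'] Suc.prems(2) by simp
  qed
  then obtain B where B: "B \<in> carrier_mat (Suc m) (Suc m)" "similar_mat B A"
    and Ba: "B $$ (0, 0) = ?a" and S_ns: "m \<le> 1 \<or> nonscalar m (schur_complement m a' B)"
    by blast
  let ?S = "schur_complement m a' B"
  have "?a * det ?S = ?a * (\<Prod>i<m. \<beta> (Suc i) * \<gamma> (Suc i))"
    using det_schur_complement[OF B(1), of a'] det_similar[OF B(2)] detA Ba a' by simp
  moreover have "a' * (?a * x) = x" for x
  proof -
    have "a' * (?a * x) = (?a * a') * x" by (simp only: ac_simps)
    thus ?thesis by (simp only: a' mult_1)
  qed
  ultimately have detS: "det ?S = (\<Prod>i<m. \<beta> (Suc i) * \<gamma> (Suc i))" by metis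
  obtain L U where L: "L \<in> carrier_mat m m" and U: "U \<in> carrier_mat m m"
    and sim: "similar_mat ?S (L * U)"
    and lower: "\<And>i j. i < j \<Longrightarrow> j < m \<Longrightarrow> L $$ (i, j) = 0"
    and upper: "\<And>i j. j < i \<Longrightarrow> i < m \<Longrightarrow> U $$ (i, j) = 0"
    and diag: "\<And>i. i < m \<Longrightarrow> L $$ (i, i) = \<beta> (Suc i)" "\<And>i. i < m \<Longrightarrow> U $$ (i, i) = \<gamma> (Suc i)"
    using Suc.IH[of ?S "\<lambda>i. \<beta> (Suc i)" "\<lambda>i. \<gamma> (Suc i)"] S_ns Suc.prems(3,4) detS by auto
  obtain P Q where PQ: "similar_mat_wit ?S (L * U) P Q" using sim unfolding similar_mat_def by blast
  note w = similar_mat_witD2[OF schur_complement_carrier PQ]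
  define c where "c = mat m 1 (\<lambda>(i, j). B $$ (Suc i, 0) * (a' * \<beta> 0))"
  define r where "r = mat 1 m (\<lambda>(i, j). (a' * \<gamma> 0) * B $$ (0, Suc j))"
  have c: "c \<in> carrier_mat m 1" and r: "r \<in> carrier_mat 1 m" by (simp_all add: c_def r_def)
  let ?M = "four_block_mat (mat11 (\<beta> 0)) (0\<^sub>m 1 m) c (1\<^sub>m m)"
  let ?N = "four_block_mat (mat11 (\<gamma> 0)) r (0\<^sub>m m 1) ?S"
  let ?L = "four_block_mat (mat11 (\<beta> 0)) (0\<^sub>m 1 m) (Q * c) L"
  let ?U = "four_block_mat (mat11 (\<gamma> 0)) (r * P) (0\<^sub>m m 1) U"
  let ?P = "four_block_mat (1\<^sub>m 1) (0\<^sub>m 1 m) (0\<^sub>m m 1) P"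
  let ?Q = "four_block_mat (1\<^sub>m 1) (0\<^sub>m 1 m) (0\<^sub>m m 1) Q"
  have BMN: "B = ?M * ?N"
    unfolding c_def r_def using corner_decomposition[OF B(1), of "\<beta> 0" "\<gamma> 0" a'] Ba a' by simp
  have cancel_left: "P * (Q * X) = X" if "X \<in> carrier_mat m k" for X k
    using assoc_mult_mat[OF w(6) w(7) that] w(1) that by simp
  have cancel_right: "X * P * Q = X" if "X \<in> carrier_mat k m" for X k
    using assoc_mult_mat[OF that w(6) w(7)] w(1) that by simp
  have Qc: "Q * c \<in> carrier_mat m 1" and rP: "r * P \<in> carrier_mat 1 m"
    using w c r by (auto intro: mult_carrier_mat)
  have b: "mat11 (\<beta> 0) \<in> carrier_mat 1 1" and g: "mat11 (\<gamma> 0) \<in> carrier_mat 1 1" by auto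
  note S = schur_complement_carrier[of m a' B]
  note zero_one = left_mult_zero_mat[OF zero_carrier_mat] right_mult_zero_mat[OF L]
    left_mult_zero_mat[OF S] left_mult_zero_mat[OF U] left_mult_one_mat[OF zero_carrier_mat] left_mult_one_mat[OF S]
    right_add_zero_mat[OF mult_carrier_mat[OF b g]] right_add_zero_mat[OF mult_carrier_mat[OF b r]]
    right_add_zero_mat[OF mult_carrier_mat[OF c g]] right_add_zero_mat[OF mult_carrier_mat[OF b rP]]
    right_add_zero_mat[OF mult_carrier_mat[OF Qc g]]
  have MN: "?M * ?N = four_block_mat (mat11 (\<beta> 0) * mat11 (\<gamma> 0)) (mat11 (\<beta> 0) * r)
      (c * mat11 (\<gamma> 0)) (c * r + ?S)"
    by (simp only: zero_one mult_four_block_mat[OF b zero_carrier_mat c one_carrier_mat g r zero_carrier_mat S])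
  have LU: "?L * ?U = four_block_mat (mat11 (\<beta> 0) * mat11 (\<gamma> 0)) (mat11 (\<beta> 0) * (r * P))
      (Q * c * mat11 (\<gamma> 0)) (Q * c * (r * P) + L * U)"
    by (simp only: zero_one mult_four_block_mat[OF b zero_carrier_mat Qc L g rP zero_carrier_mat U])
  have corner: "P * (Q * c * (r * P) + L * U) * Q = c * r + ?S"
  proof -
    have cr: "c * r \<in> carrier_mat m m" and LU: "L * U \<in> carrier_mat m m"
      using c r L U by (auto intro: mult_carrier_mat)
    have "Q * c * (r * P) = Q * (c * (r * P))" by (rule assoc_mult_mat[OF w(7) c rP])
    also have "c * (r * P) = c * r * P" by (rule assoc_mult_mat[OF c r w(6), symmetric])
    finally have X: "Q * c * (r * P) = Q * (c * r * P)" .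
    have crP: "c * r * P \<in> carrier_mat m m" by (rule mult_carrier_mat[OF cr w(6)])
    have "P * (Q * (c * r * P) + L * U) = P * (Q * (c * r * P)) + P * (L * U)"
      by (rule mult_add_distrib_mat[OF w(6) mult_carrier_mat[OF w(7) crP] LU])
    also have "\<dots> = c * r * P + P * (L * U)" by (simp only: cancel_left[OF crP])
    also have "\<dots> * Q = c * r * P * Q + P * (L * U) * Q"
      by (rule add_mult_distrib_mat[OF crP mult_carrier_mat[OF w(6) LU] w(7)])
    also have "\<dots> = c * r + ?S" by (simp only: cancel_right[OF cr] w(3)[symmetric])
    finally show ?thesis by (simp only: X)
  qed
  let ?A1 = "mat11 (\<beta> 0) * mat11 (\<gamma> 0)"
  let ?R = "mat11 (\<beta> 0) * (r * P)" and ?C = "Q * c * mat11 (\<gamma> 0)" and ?D = "Q * c * (r * P) + L * U"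
  have D: "?D \<in> carrier_mat m m" using Qc rP L U by (auto intro: mult_carrier_mat)
  have A1: "?A1 \<in> carrier_mat 1 1" by (rule mult_carrier_mat[OF b g])
  have R: "?R \<in> carrier_mat 1 m" by (rule mult_carrier_mat[OF b rP])
  have C: "?C \<in> carrier_mat m 1" by (rule mult_carrier_mat[OF Qc g])
  have crS: "c * r + ?S \<in> carrier_mat m m" using c r by (auto intro: mult_carrier_mat)
  have "similar_mat_wit (four_block_mat ?A1 (mat11 (\<beta> 0) * r) (c * mat11 (\<gamma> 0)) (c * r + ?S))
      (four_block_mat ?A1 ?R ?C ?D) ?P ?Q"
  proof (rule similar_mat_wit_four_block[OF similar_mat_wit_refl[OF A1] _ _ _ A1 crS C R])
    show "similar_mat_wit (c * r + ?S) ?D P Q"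
      by (rule similar_mat_witI[OF w(1,2) corner[symmetric] crS D w(6,7)])
    have "mat11 (\<beta> 0) * r = mat11 (\<beta> 0) * r * P * Q"
      using cancel_right[OF mult_carrier_mat[OF b r]] by simp
    also have "\<dots> = ?R * Q" by (simp only: assoc_mult_mat[OF b r w(6)])
    finally show "mat11 (\<beta> 0) * r = 1\<^sub>m 1 * ?R * Q" by (simp only: left_mult_one_mat[OF R])
    have "P * ?C = P * (Q * (c * mat11 (\<gamma> 0)))" by (simp only: assoc_mult_mat[OF w(7) c g])
    also have "\<dots> = c * mat11 (\<gamma> 0)" by (rule cancel_left[OF mult_carrier_mat[OF c g]])
    finally have "P * ?C = c * mat11 (\<gamma> 0)" .
    thus "c * mat11 (\<gamma> 0) = P * ?C * 1\<^sub>m 1"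
      by (simp only: right_mult_one_mat[OF mult_carrier_mat[OF c g]])
  qed
  hence "similar_mat (?M * ?N) (?L * ?U)" unfolding similar_mat_def MN LU by blast
  hence "similar_mat B (?L * ?U)" by (simp only: BMN[symmetric])
  hence simA: "similar_mat A (?L * ?U)" using similar_mat_trans[OF similar_mat_sym[OF B(2)]] by blast
  have carrier: "?L \<in> carrier_mat (Suc m) (Suc m)" "?U \<in> carrier_mat (Suc m) (Suc m)"
    using L U by auto
  have low: "\<forall>i j. i < j \<longrightarrow> j < Suc m \<longrightarrow> ?L $$ (i, j) = 0"
    using L Qc lower by (auto simp: less_Suc_eq_0_disj)
  have up: "\<forall>i j. j < i \<longrightarrow> i < Suc m \<longrightarrow> ?U $$ (i, j) = 0"
    using U rP upper by (auto simp: less_Suc_eq_0_disj)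
  have diagonal: "\<forall>i<Suc m. ?L $$ (i, i) = \<beta> i \<and> ?U $$ (i, i) = \<gamma> i"
    using L U diag by (auto simp: less_Suc_eq_0_disj)
  show ?case by (rule exI[of _ ?L], rule exI[of _ ?U]) (intro conjI carrier simA low up diagonal)
qed

end

section \<open>Commutators in the special linear group\<close>

lemma SL_commutatorI:
  fixes X Y :: "'a :: comm_ring_1 mat"
  assumes carr: "X \<in> carrier_mat n n" "X' \<in> carrier_mat n n" "Y \<in> carrier_mat n n" "Y' \<in> carrier_mat n n"
    and det: "det X = 1" "det Y = 1"
    and inv: "X' * X = 1\<^sub>m n" "Y' * Y = 1\<^sub>m n"
    and A: "A = X * Y * X' * Y'"
  shows "A \<in> derived_set (SL TYPE('a) n) (carrier (SL TYPE('a) n))"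
proof -
  let ?G = "SL TYPE('a) n"
  interpret G: group ?G by (rule group_SL)
  have det_inv: "det V = 1" if "V * W = 1\<^sub>m n" "V \<in> carrier_mat n n" "W \<in> carrier_mat n n" "det W = 1"
    for V W :: "'a mat"
    using det_mult[OF that(2,3)] that(1,4) by simp
  have X: "X \<in> carrier ?G" "X' \<in> carrier ?G" and Y: "Y \<in> carrier ?G" "Y' \<in> carrier ?G"
    using carr det det_inv[OF inv(1)] det_inv[OF inv(2)] by (simp_all add: SL_def)
  have "inv\<^bsub>?G\<^esub> X = X'" by (rule G.inv_equality[OF _ X]) (simp add: SL_def inv)
  moreover have "inv\<^bsub>?G\<^esub> Y = Y'" by (rule G.inv_equality[OF _ Y]) (simp add: SL_def inv)
  ultimately have "A = X \<otimes>\<^bsub>?G\<^esub> Y \<otimes>\<^bsub>?G\<^esub> inv\<^bsub>?G\<^esub> X \<otimes>\<^bsub>?G\<^esub> inv\<^bsub>?G\<^esub> Y"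
    by (simp only: A) (simp add: SL_def)
  thus ?thesis using X(1) Y(1) by blast
qed

text \<open>
  With \<open>L = P D Q\<close> and \<open>U = P' D' Q'\<close>, where \<open>Q\<close> and \<open>Q'\<close> invert \<open>P\<close> and \<open>P'\<close>, put \<open>R = P' Q\<close>.
  Then \<open>U = R (P D' Q) R\<inverse>\<close>, and as \<open>P D' Q\<close> is the inverse of \<open>L\<close>, the product \<open>L U\<close> is the
  commutator of \<open>L\<close> and \<open>R\<close>. Conjugating both by \<open>S\<close>, which may have any determinant, gives \<open>A\<close>.
\<close>

lemma product_of_conjugates_of_inverses_is_commutator:
  fixes A :: "'a :: comm_ring_1 mat"
  assumes A: "A \<in> carrier_mat n n" and sim: "similar_mat_wit A (L * U) S T"
    and L: "L \<in> carrier_mat n n" and LD: "similar_mat_wit L D P Q" and detP: "det P = 1"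
    and U: "U \<in> carrier_mat n n" and UD: "similar_mat_wit U D' P' Q'" and detP': "det P' = 1"
    and D: "D * D' = 1\<^sub>m n" "D' * D = 1\<^sub>m n" "det D = 1"
  shows "A \<in> derived_set (SL TYPE('a) n) (carrier (SL TYPE('a) n))"
proof (rule SL_commutatorI)
  note s = similar_mat_witD2[OF A sim] and l = similar_mat_witD2[OF L LD]
    and u = similar_mat_witD2[OF U UD]
  note [simp] = s(6,7) l(5-7) u(5-7)
  note assoc = assoc_mult_mat[of _ n n _ n _ n]
  have [simp]: "X * Y \<in> carrier_mat n n" if "X \<in> carrier_mat n n" "Y \<in> carrier_mat n n" for X Y :: "'a mat"
    using that by (rule mult_carrier_mat)
  have cancel: "V * (W * X) = X" if "V * W = 1\<^sub>m n" "V \<in> carrier_mat n n" "W \<in> carrier_mat n n"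
    "X \<in> carrier_mat n n" for V W X :: "'a mat"
    using that assoc_mult_mat[of V n n W n X n] by simp
  note cancels = cancel[OF s(1)] cancel[OF s(2)] cancel[OF l(1)] cancel[OF l(2)] cancel[OF u(1)] cancel[OF u(2)]
    cancel[OF D(1)] cancel[OF D(2)]
  have det_inverse: "det V * det W = 1" if "V * W = 1\<^sub>m n" "V \<in> carrier_mat n n" "W \<in> carrier_mat n n"
    for V W :: "'a mat"
    using det_mult[OF that(2,3)] that(1) by simp
  let ?X = "S * (P * (D * (Q * T)))" and ?X' = "S * (P * (D' * (Q * T)))"
  let ?Y = "S * (P' * (Q * T))" and ?Y' = "S * (P * (Q' * T))"
  show "?X \<in> carrier_mat n n" "?X' \<in> carrier_mat n n" "?Y \<in> carrier_mat n n" "?Y' \<in> carrier_mat n n"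
    by simp_all
  have "det ?X = (det S * det T) * (det P * det Q) * det D"
    by (simp add: det_mult[of _ n] ac_simps)
  thus "det ?X = 1" using det_inverse[OF s(1)] det_inverse[OF l(1)] D(3) by simp
  have "det ?Y = (det S * det T) * (det P' * det Q)"
    by (simp add: det_mult[of _ n] ac_simps)
  moreover have "det Q = 1" using det_inverse[OF l(1)] detP by simp
  ultimately show "det ?Y = 1" using det_inverse[OF s(1)] detP' by simp
  show "?X' * ?X = 1\<^sub>m n" by (simp add: assoc cancels s)
  show "?Y' * ?Y = 1\<^sub>m n" by (simp add: assoc cancels s)
  have "A = S * (P * (D * (Q * (P' * (D' * (Q' * T))))))"
    using s(3) l(3) u(3) by (simp add: assoc)
  thus "A = ?X * ?Y * ?X' * ?Y'" by (simp add: assoc cancels)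
qed

lemma (in nonunit_ideal) not_scalar_modulo_imp_nonscalar:
  assumes ideal: "ideal \<mm> (class_ring :: 'a ring)" and A: "A \<in> carrier_mat n n" and n: "n > 0"
    and ns: "\<not> scalar_modulo (class_ring :: 'a ring) \<mm> n A"
  shows "nonscalar n A"
proof (rule ccontr)
  let ?R = "class_ring :: 'a ring"
  let ?c = "\<lambda>a. \<mm> +>\<^bsub>?R\<^esub> a"
  interpret ideal \<mm> ?R by (rule ideal)
  assume s: "\<not> nonscalar n A"
  let ?a = "A $$ (0, 0)"
  have off: "A $$ (i, j) \<in> \<mm>" if "i < n" "j < n" "i \<noteq> j" for i j
    using s that unfolding nonscalar_def by blast
  have diag: "A $$ (i, i) - ?a \<in> \<mm>" if "i < n" for i
    using s that n unfolding nonscalar_def by blast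
  have mult: "?c a \<otimes>\<^bsub>?R Quot \<mm>\<^esub> ?c b = ?c (a * b)" for a b
    using rcoset_mult_add[of a b] by (simp add: FactRing_def)
  have "reduce_mat ?R \<mm> A = scalar_mat_over (?R Quot \<mm>) n (?c ?a)"
  proof (rule eq_matI)
    fix i j assume "i < dim_row (scalar_mat_over (?R Quot \<mm>) n (?c ?a))"
      "j < dim_col (scalar_mat_over (?R Quot \<mm>) n (?c ?a))"
    hence ij: "i < n" "j < n" by (auto simp: scalar_mat_over_def)
    have "\<one>\<^bsub>?R Quot \<mm>\<^esub> = ?c 1" "\<zero>\<^bsub>?R Quot \<mm>\<^esub> = ?c 0"
      by (auto simp: FactRing_def a_r_coset_def r_coset_def)
    hence "scalar_mat_over (?R Quot \<mm>) n (?c ?a) $$ (i, j) = ?c (?a * (if i = j then 1 else 0))"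
      using ij by (simp add: scalar_mat_over_def mult[of _ 0] mult[of _ 1])
    moreover have "?c (A $$ (i, j)) = ?c (?a * (if i = j then 1 else 0))"
      unfolding coset_eq_iff using off diag ij by simp
    ultimately show "reduce_mat ?R \<mm> A $$ (i, j) = scalar_mat_over (?R Quot \<mm>) n (?c ?a) $$ (i, j)"
      using A ij by (simp add: reduce_mat_def)
  qed (use A in \<open>auto simp: reduce_mat_def scalar_mat_over_def\<close>)
  moreover have "?c ?a \<in> carrier (?R Quot \<mm>)"
    by (auto simp: FactRing_def A_RCOSETS_def RCOSETS_def a_r_coset_def)
  ultimately show False using ns unfolding scalar_modulo_def by blast
qed

theorem theorem3p5:
  fixes n :: nat and \<mm> :: "'a :: comm_ring_1 set" and A :: "'a mat"
  assumes "n > 0"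
    and "local_ring_with (class_ring :: 'a ring) \<mm>"
    and "infinite (carrier ((class_ring :: 'a ring) Quot \<mm>)) \<or>
         card (carrier ((class_ring :: 'a ring) Quot \<mm>)) > n + 1"
    and "A \<in> carrier (SL TYPE('a) n)"
    and "\<not> scalar_modulo (class_ring :: 'a ring) \<mm> n A"
  shows "A \<in> derived_set (SL TYPE('a) n) (carrier (SL TYPE('a) n))"
proof -
  interpret nonunit_ideal \<mm> using assms(2) by (rule local_ring_with_nonunit_ideal)
  have A: "A \<in> carrier_mat n n" and detA: "det A = 1" using assms(4) by (simp_all add: SL_def)
  have "ideal \<mm> (class_ring :: 'a ring)"
    using assms(2) by (simp add: local_ring_with_def maximalideal_def)
  hence ns: "nonscalar n A" using not_scalar_modulo_imp_nonscalar A assms(1,5) by blast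
  \<comment> \<open>Distinct eigenvalues modulo \<open>\<mm>\<close> for \<open>L\<close>; their inverses are prescribed for \<open>U\<close>.\<close>
  obtain T where T: "finite T" "card T = n" "\<Prod>T = 1" and inv: "\<forall>x\<in>T. \<exists>y\<in>T. x * y = 1"
    and dist: "\<forall>x\<in>T. \<forall>y\<in>T. x \<noteq> y \<longrightarrow> x - y \<notin> \<mm>"
    using distinct_units_with_prod_one[OF large_residue_field_avoids[OF assms(3)]] by blast
  obtain \<beta> where \<beta>: "bij_betw \<beta> {..<n} T"
    using ex_bij_betw_nat_finite[OF T(1)] T(2) by (auto simp: atLeast0LessThan)
  have \<beta>T: "\<beta> i \<in> T" if "i < n" for i using bij_betwE[OF \<beta>] that by simp
  have "\<exists>y. \<beta> i * y = 1" if "i < n" for i using inv \<beta>T[OF that] by blast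
  then obtain \<gamma> where \<gamma>: "\<And>i. i < n \<Longrightarrow> \<beta> i * \<gamma> i = 1" by metis
  have units: "\<beta> i \<notin> \<mm>" "\<gamma> i \<notin> \<mm>" if "i < n" for i using \<gamma>[OF that] by (metis mult_iff one)+
  have \<beta>_dist: "\<beta> i - \<beta> j \<notin> \<mm>" if "i < j" "j < n" for i j
  proof -
    have "\<beta> i \<noteq> \<beta> j" using \<beta> that by (auto simp: bij_betw_def inj_on_def)
    thus ?thesis using dist \<beta>T that by simp
  qed
  have \<gamma>_dist: "\<gamma> i - \<gamma> j \<notin> \<mm>" if "i < j" "j < n" for i j
  proof -
    have i: "i < n" using that by simp
    have "\<beta> i * \<beta> j * (\<gamma> i - \<gamma> j) = (\<beta> i * \<gamma> i) * \<beta> j - \<beta> i * (\<beta> j * \<gamma> j)"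
      by (simp add: algebra_simps)
    also have "\<dots> = \<beta> j - \<beta> i" using \<gamma>[OF i] \<gamma>[OF that(2)] by simp
    finally have "\<beta> i * \<beta> j * (\<gamma> i - \<gamma> j) \<notin> \<mm>" using \<beta>_dist[OF that] diff_commute by metis
    thus ?thesis by simp
  qed
  have "det A = (\<Prod>i<n. \<beta> i * \<gamma> i)" using detA \<gamma> by simp
  then obtain L U where L: "L \<in> carrier_mat n n" and U: "U \<in> carrier_mat n n"
    and sim: "similar_mat A (L * U)"
    and lower: "\<And>i j. i < j \<Longrightarrow> j < n \<Longrightarrow> L $$ (i, j) = 0"
    and upper: "\<And>i j. j < i \<Longrightarrow> i < n \<Longrightarrow> U $$ (i, j) = 0"
    and diag: "\<And>i. i < n \<Longrightarrow> L $$ (i, i) = \<beta> i" "\<And>i. i < n \<Longrightarrow> U $$ (i, i) = \<gamma> i"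
    using nonscalar_similar_lower_times_upper[of A n \<beta> \<gamma>] A ns units by auto
  obtain S R where SR: "similar_mat_wit A (L * U) S R" using sim unfolding similar_mat_def by blast
  obtain P Q where PQ: "similar_mat_wit L (mat_diag n \<beta>) P Q" "det P = 1"
    using lower_triangular_diagonalisable[OF L lower diag(1) \<beta>_dist] by blast
  obtain P' Q' where PQ': "similar_mat_wit U (mat_diag n \<gamma>) P' Q'" "det P' = 1"
    using upper_triangular_diagonalisable[OF U upper diag(2) \<gamma>_dist] by blast
  have "mat_diag n (\<lambda>i. \<beta> i * \<gamma> i) = 1\<^sub>m n" using \<gamma> by (intro eq_matI) (auto simp: mat_diag_def)
  hence DD: "mat_diag n \<beta> * mat_diag n \<gamma> = 1\<^sub>m n" "mat_diag n \<gamma> * mat_diag n \<beta> = 1\<^sub>m n"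
    by (simp_all add: mult.commute)
  have "det (mat_diag n \<beta>) = prod_list (diag_mat (mat_diag n \<beta>))"
    by (rule det_upper_triangular[of _ n]) (auto simp: mat_diag_def)
  also have "\<dots> = (\<Prod>i<n. \<beta> i)"
    by (simp add: prod_list_diag_prod mat_diag_def atLeast0LessThan)
  also have "\<dots> = 1" using prod.reindex_bij_betw[OF \<beta>, of "\<lambda>x. x"] T(3) by simp
  finally have detD: "det (mat_diag n \<beta>) = 1" .
  show ?thesis
    by (rule product_of_conjugates_of_inverses_is_commutator[OF A SR L PQ U PQ' DD detD])
qed

end
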